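(* Let $n\ge 1$, $z_k=x_k+iy_k\in\mathbb C$ and $\Gamma_k\in\mathbb R$ for $k=1,\dots,n$, and put $$\mathcal H_0(z_1,\dots,z_n)=-\frac1{2\pi}\sum_{k<l}\Gamma_k\Gamma_l\log\big|\theta_1\big(i(z_k-z_l),e^{-2\pi}\big)\big|+\frac1{4\pi}\sum_{k\ne l}\Gamma_k\Gamma_l\log\big|\theta_1\big(i(z_k-\bar z_l-\pi),e^{-2\pi}\big)\big|$$ $$\qquad+\frac1{4\pi}\sum_k\Gamma_k^2\log\big|\theta_1\big(2y_k+i\pi,e^{-2\pi}\big)\big|,$$ where the second sum is over ordered pairs $(k,l)$ with $k\neq l$. Let $\tau(z)=\bar z+\pi$. Then, wherever the expressions are defined, $$\mathcal H_0(\tau(z_1),z_2,\dots,z_n)=\mathcal H_0(z_1,\dots,z_n)-\frac12\sum_{k\ne1}\Gamma_1\Gamma_k,$$ where on the left-hand side the strength $\Gamma_1$ is simultaneously replaced by $-\Gamma_1$, while on the right-hand side $\Gamma_1$ is the original strength.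
   Context: $\theta_1(z,q)=2\sum_{n\ge0}(-1)^nq^{(n+1/2)^2}\sin((2n+1)z)$ is the first Jacobi theta function. Vortex strengths are twisted scalars: applying the orientation-reversing involution $\tau$ to a vortex also reverses the sign of its strength. *)

theory Defs
  imports "HOL-Analysis.Analysis"
begin

text \<open>The first Jacobi theta function in the nome convention. The series converges for
  \<open>norm q < 1\<close>. The fractional powers of the nome are principal values, which for
  \<open>0 < q < 1\<close> are the usual positive real powers.\<close>

definition theta1 :: "complex \<Rightarrow> complex \<Rightarrow> complex" where
  "theta1 z q =
     2 * (\<Sum>n. (- 1) ^ n * q powr ((of_nat n + 1 / 2)\<^sup>2) * sin ((2 * of_nat n + 1) * z))"

definition nome :: complex where
  "nome = complex_of_real (exp (- 2 * pi))"

text \<open>The strengths \<open>\<Gamma>\<close> and positions \<open>z\<close> are sequences of which only the entries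
  \<open>1, \<dots>, n\<close> are used. The second sum runs over ordered pairs of distinct indices.\<close>

definition H0 :: "nat \<Rightarrow> (nat \<Rightarrow> real) \<Rightarrow> (nat \<Rightarrow> complex) \<Rightarrow> real" where
  "H0 n \<Gamma> z =
     - 1 / (2 * pi) * (\<Sum>k\<in>{1..n}. \<Sum>l\<in>{k<..n}.
         \<Gamma> k * \<Gamma> l * ln (norm (theta1 (\<i> * (z k - z l)) nome)))
     + 1 / (4 * pi) * (\<Sum>k\<in>{1..n}. \<Sum>l\<in>{1..n} - {k}.
         \<Gamma> k * \<Gamma> l * ln (norm (theta1 (\<i> * (z k - cnj (z l) - of_real pi)) nome)))
     + 1 / (4 * pi) * (\<Sum>k\<in>{1..n}.
         (\<Gamma> k)\<^sup>2 * ln (norm (theta1 (of_real (2 * Im (z k)) + \<i> * of_real pi) nome)))"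

text \<open>Since \<open>ln 0 = 0\<close> in HOL, definedness of \<open>H0\<close> has to be stated separately: no logarithm
  occurring in it is taken at \<open>0\<close>.\<close>

definition H0_defined :: "nat \<Rightarrow> (nat \<Rightarrow> complex) \<Rightarrow> bool" where
  "H0_defined n z \<longleftrightarrow>
     (\<forall>k\<in>{1..n}. \<forall>l\<in>{k<..n}. theta1 (\<i> * (z k - z l)) nome \<noteq> 0) \<and>
     (\<forall>k\<in>{1..n}. \<forall>l\<in>{1..n} - {k}. theta1 (\<i> * (z k - cnj (z l) - of_real pi)) nome \<noteq> 0) \<and>
     (\<forall>k\<in>{1..n}. theta1 (of_real (2 * Im (z k)) + \<i> * of_real pi) nome \<noteq> 0)"

definition tau :: "complex \<Rightarrow> complex" where
  "tau z = cnj z + of_real pi"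

end

theory Submission
  imports Defs
begin

text \<open>Splitting the sine into exponentials and shifting the summation index by one shows that
  \<open>\<theta>\<^sub>1\<close> picks up the factor \<open>- exp (s - 2 \<i> z)\<close> under \<open>z \<mapsto> z + \<i> s\<close>, where \<open>exp (- s)\<close> is the
  nome. Together with oddness and reality, this determines how each logarithm changes: \<open>\<tau>\<close> on
  \<open>z\<^sub>1\<close> interchanges the direct and the image interactions of vortex \<open>1\<close> with vortex \<open>l\<close>, up to
  multiples of \<open>Re (z\<^sub>1 - z\<^sub>l)\<close>, which cancel, and a constant. The self-interaction terms are
  invariant.\<close>

text \<open>One exponential half of the sine series; the nome is \<open>exp (- s)\<close>, so that
  its power and the sine factor merge into a single \<open>exp\<close> and shifts of
  \<open>z\<close> become identities between exponents.\<close>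

definition theta_term :: "real \<Rightarrow> complex \<Rightarrow> nat \<Rightarrow> complex" where
  "theta_term s z n =
     (- 1) ^ n * exp (- of_real s * (of_nat n + 1 / 2)\<^sup>2 + (2 * of_nat n + 1) * (\<i> * z))"

lemma summable_theta_term:
  assumes "s > 0"
  shows "summable (theta_term s z)"
proof -
  have norm_term: "norm (theta_term s z n) = exp (- s * (real n + 1 / 2)\<^sup>2 - (2 * real n + 1) * Im z)" for n
  proof -
    have "(complex_of_nat n + 1 / 2)\<^sup>2 = of_real ((real n + 1 / 2)\<^sup>2)"
      by simp
    then have "Re (- of_real s * (of_nat n + 1 / 2)\<^sup>2 + (2 * of_nat n + 1) * (\<i> * z)) =
        - s * (real n + 1 / 2)\<^sup>2 - (2 * real n + 1) * Im z"
      by (simp only: minus_complex.sel plus_complex.sel times_complex.sel uminus_complex.sel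
            Re_complex_of_real Im_complex_of_real) simp
    then show ?thesis
      by (simp add: theta_term_def norm_mult norm_power)
  qed
  \<comment> \<open>Successive norms have ratio \<open>exp (- 2 * s * (n + 1) - 2 * Im z)\<close>;
    beyond this \<open>N\<close> the ratio is at most \<open>exp (- 1)\<close>.\<close>
  obtain N where N: "real N \<ge> (1 - 2 * Im z) / (2 * s)"
    using real_arch_simple by blast
  have "norm (theta_term s z (Suc n)) \<le> exp (- 1) * norm (theta_term s z n)" if "n \<ge> N" for n
  proof -
    have "real n \<ge> (1 - 2 * Im z) / (2 * s)"
      using N that by (meson of_nat_le_iff order_trans)
    then have "1 - 2 * Im z \<le> 2 * s * (real n + 1)"
      using assms by (simp add: field_simps)
    then have "- s * (real (Suc n) + 1 / 2)\<^sup>2 - (2 * real (Suc n) + 1) * Im z \<le>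
        - 1 + (- s * (real n + 1 / 2)\<^sup>2 - (2 * real n + 1) * Im z)"
      by (simp add: power2_eq_square algebra_simps)
    then show ?thesis
      unfolding norm_term by (simp flip: exp_add)
  qed
  then show ?thesis
    by (intro summable_ratio_test[of "exp (- 1)" N]) auto
qed

text \<open>Both halves converge on their own, so the series may be split into two sums that can be
  reindexed independently.\<close>

lemma theta1_conv_theta_term:
  assumes "s > 0"
  shows "theta1 z (of_real (exp (- s))) =
    - \<i> * ((\<Sum>n. theta_term s z n) - (\<Sum>n. theta_term s (- z) n))"
proof -
  have "2 * ((- 1) ^ n * complex_of_real (exp (- s)) powr ((of_nat n + 1 / 2)\<^sup>2) *
          sin ((2 * of_nat n + 1) * z)) =
        - \<i> * (theta_term s z n - theta_term s (- z) n)" for n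
  proof -
    \<comment> \<open>The principal logarithm of the positive real \<open>exp (- s)\<close> is
      \<open>- s\<close>.\<close>
    have "complex_of_real (exp (- s)) powr ((of_nat n + 1 / 2)\<^sup>2) =
        exp (- of_real s * (of_nat n + 1 / 2)\<^sup>2)"
      by (simp add: powr_def Ln_of_real mult.commute del: of_real_exp)
    moreover have "sin ((2 * of_nat n + 1) * z) =
        - (\<i> / 2) * (exp ((2 * of_nat n + 1) * (\<i> * z)) - exp ((2 * of_nat n + 1) * (\<i> * - z)))"
      by (simp add: sin_exp_eq mult_ac divide_simps)
    ultimately show ?thesis
      by (simp only: theta_term_def exp_add) (simp add: right_diff_distrib mult_ac)
  qed
  note eq = this
  have sm: "summable (\<lambda>n. theta_term s z n - theta_term s (- z) n)"
    by (intro summable_diff summable_theta_term assms)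
  have "(\<lambda>n. (- \<i> / 2) * (theta_term s z n - theta_term s (- z) n)) =
      (\<lambda>n. (- 1) ^ n * complex_of_real (exp (- s)) powr ((of_nat n + 1 / 2)\<^sup>2) *
          sin ((2 * of_nat n + 1) * z))"
    using eq by (intro ext) (simp add: field_simps)
  then have "theta1 z (of_real (exp (- s))) =
      2 * (\<Sum>n. (- \<i> / 2) * (theta_term s z n - theta_term s (- z) n))"
    unfolding theta1_def by simp
  also have "\<dots> = 2 * ((- \<i> / 2) * (\<Sum>n. theta_term s z n - theta_term s (- z) n))"
    by (subst suminf_mult[OF sm]) simp
  also have "\<dots> = - \<i> * ((\<Sum>n. theta_term s z n) - (\<Sum>n. theta_term s (- z) n))"
    by (subst suminf_diff[symmetric]) (auto intro: summable_theta_term assms)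
  finally show ?thesis .
qed

lemma theta1_minus:
  assumes "s > 0"
  shows "theta1 (- z) (of_real (exp (- s))) = - theta1 z (of_real (exp (- s)))"
  by (simp add: theta1_conv_theta_term[OF assms] algebra_simps del: of_real_exp)

text \<open>Conjugation sends \<open>\<i> * z\<close> to \<open>\<i> * (- cnj z)\<close>, so it
  interchanges the two halves; the conjugate of the prefactor \<open>- \<i>\<close> makes up for the
  sign.\<close>

lemma theta1_cnj:
  assumes "s > 0"
  shows "theta1 (cnj z) (of_real (exp (- s))) = cnj (theta1 z (of_real (exp (- s))))"
proof -
  have "cnj (theta_term s w n) = theta_term s (- cnj w) n" for w n
    by (simp add: theta_term_def exp_cnj algebra_simps)
  then have "cnj (\<Sum>n. theta_term s w n) = (\<Sum>n. theta_term s (- cnj w) n)" for w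
    using bounded_linear.suminf[OF bounded_linear_cnj summable_theta_term[OF assms], of w] by simp
  then show ?thesis
    by (simp add: theta1_conv_theta_term[OF assms] algebra_simps del: of_real_exp)
qed

text \<open>Completing the square in the exponent turns the shift of \<open>z\<close> into an index
  shift, in opposite directions for the two halves.\<close>

lemma theta1_quasi_period:
  assumes "s > 0"
  shows "theta1 (z + \<i> * of_real s) (of_real (exp (- s))) =
    - exp (of_real s - 2 * \<i> * z) * theta1 z (of_real (exp (- s)))"
proof -
  define c where "c = exp (of_real s - 2 * \<i> * z)"
  define U where "U w = (\<Sum>n. theta_term s w n)" for w
  have "theta_term s (z + \<i> * of_real s) = (\<lambda>n. - c * theta_term s z (Suc n))"
    by (rule ext) (simp add: theta_term_def c_def power2_eq_square algebra_simps flip: exp_add)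
  then have "U (z + \<i> * of_real s) = - c * (\<Sum>n. theta_term s z (Suc n))"
    unfolding U_def
    by (simp only: suminf_mult[OF iffD2[OF summable_Suc_iff summable_theta_term[OF assms]]])
  then have pos: "U (z + \<i> * of_real s) = - c * (U z - theta_term s z 0)"
    unfolding U_def by (simp add: suminf_split_head[OF summable_theta_term[OF assms]])
  have "theta_term s (- (z + \<i> * of_real s)) (Suc n) = - c * theta_term s (- z) n" for n
    by (simp add: theta_term_def c_def power2_eq_square algebra_simps flip: exp_add)
  then have "(\<Sum>n. theta_term s (- (z + \<i> * of_real s)) (Suc n)) = - c * U (- z)"
    unfolding U_def by (simp only: suminf_mult[OF summable_theta_term[OF assms]])
  then have neg: "U (- (z + \<i> * of_real s)) =
      theta_term s (- (z + \<i> * of_real s)) 0 - c * U (- z)"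
    unfolding U_def
    using suminf_split_head[OF summable_theta_term[OF assms], of "- (z + \<i> * of_real s)"]
    by (simp add: algebra_simps)
  \<comment> \<open>The boundary terms left over by the two index shifts agree, hence cancel in the
    difference of the halves.\<close>
  have "theta_term s (- (z + \<i> * of_real s)) 0 = c * theta_term s z 0"
    by (simp add: theta_term_def c_def power2_eq_square algebra_simps flip: exp_add)
  with pos neg have "U (z + \<i> * of_real s) - U (- (z + \<i> * of_real s)) = - c * (U z - U (- z))"
    by (simp add: algebra_simps)
  then show ?thesis
    unfolding theta1_conv_theta_term[OF assms] c_def[symmetric] U_def[symmetric]
    by (simp only:) simp
qed

lemma nome_eq: "nome = of_real (exp (- (2 * pi)))"
  by (simp add: nome_def)

lemma norm_theta1_nome_minus: "norm (theta1 (- z) nome) = norm (theta1 z nome)"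
  unfolding nome_eq by (subst theta1_minus) auto

lemma norm_theta1_nome_cnj: "norm (theta1 (cnj z) nome) = norm (theta1 z nome)"
  unfolding nome_eq by (subst theta1_cnj) (auto simp del: of_real_exp)

text \<open>Quasi-periodicity at \<open>s = 2 * pi\<close>, whose factor has modulus
  \<open>exp (2 * pi + 2 * Im z)\<close>. As \<open>ln 0 = 0\<close>, splitting the logarithm relies
  on nonvanishing.\<close>

lemma ln_norm_theta1_nome_shift:
  assumes "theta1 z nome \<noteq> 0"
  shows "ln (norm (theta1 (z + 2 * \<i> * of_real pi) nome)) =
    ln (norm (theta1 z nome)) + 2 * Im z + 2 * pi"
proof -
  have "theta1 (z + 2 * \<i> * of_real pi) nome =
      - exp (2 * of_real pi - 2 * \<i> * z) * theta1 z nome"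
    using theta1_quasi_period[of "2 * pi" z] by (simp add: nome_eq mult_ac)
  then have "norm (theta1 (z + 2 * \<i> * of_real pi) nome) =
      exp (2 * pi + 2 * Im z) * norm (theta1 z nome)"
    by (simp add: norm_mult)
  then show ?thesis
    using assms by (simp add: ln_mult)
qed

text \<open>Exchanging \<open>a\<close> and \<open>b\<close> amounts, up to sign and conjugation, to
  the shift by \<open>2 * \<i> * pi\<close>. Its constant \<open>2 * pi\<close> is absorbed by
  \<open>Im w = Re (a - b) - pi\<close>.\<close>

lemma ln_norm_theta1_image_swap:
  assumes "theta1 (\<i> * (a - cnj b - of_real pi)) nome \<noteq> 0"
  shows "ln (norm (theta1 (\<i> * (b - cnj a - of_real pi)) nome)) =
    ln (norm (theta1 (\<i> * (a - cnj b - of_real pi)) nome)) + 2 * Re (a - b)"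
proof -
  define w where "w = \<i> * (cnj a - b - of_real pi)"
  have w: "norm (theta1 w nome) = norm (theta1 (\<i> * (a - cnj b - of_real pi)) nome)"
    using norm_theta1_nome_cnj[of "- w"] norm_theta1_nome_minus[of w]
    by (simp add: w_def algebra_simps)
  then have "theta1 w nome \<noteq> 0"
    using assms by auto
  from ln_norm_theta1_nome_shift[OF this] w show ?thesis
    using norm_theta1_nome_minus[of "w + 2 * \<i> * of_real pi"]
    by (simp add: w_def algebra_simps)
qed

lemma sum_split_first:
  fixes F :: "nat \<Rightarrow> 'a::comm_monoid_add"
  assumes "n \<ge> 1"
  shows "(\<Sum>k\<in>{1..n}. F k) = F 1 + (\<Sum>k\<in>{2..n}. F k)"
  using sum.atLeast_Suc_atMost[OF assms, of F] by (simp add: numeral_2_eq_2)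

lemma sum_pairs_split_first:
  fixes F :: "nat \<Rightarrow> nat \<Rightarrow> 'a::comm_monoid_add"
  assumes "n \<ge> 1"
  shows "(\<Sum>k\<in>{1..n}. \<Sum>l\<in>{k<..n}. F k l) =
    (\<Sum>l\<in>{2..n}. F 1 l) + (\<Sum>k\<in>{2..n}. \<Sum>l\<in>{k<..n}. F k l)"
proof -
  have "{1<..n} = {2..n}"
    by auto
  then show ?thesis
    by (simp only: sum_split_first[OF assms])
qed

text \<open>Both orders \<open>F 1 l\<close> and \<open>F l 1\<close> are kept, because the image
  logarithm is not symmetric in its two vortices.\<close>

lemma sum_distinct_pairs_split_first:
  fixes F :: "nat \<Rightarrow> nat \<Rightarrow> 'a::comm_monoid_add"
  assumes "n \<ge> 1"
  shows "(\<Sum>k\<in>{1..n}. \<Sum>l\<in>{1..n} - {k}. F k l) =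
    (\<Sum>l\<in>{2..n}. F 1 l + F l 1) + (\<Sum>k\<in>{2..n}. \<Sum>l\<in>{2..n} - {k}. F k l)"
proof -
  have "{1..n} - {1} = {2..n}"
    by auto
  moreover have "(\<Sum>l\<in>{1..n} - {k}. F k l) = F k 1 + (\<Sum>l\<in>{2..n} - {k}. F k l)"
    if "k \<in> {2..n}" for k
  proof -
    have "{1..n} - {k} = insert 1 ({2..n} - {k})"
      using that by auto
    then show ?thesis
      by simp
  qed
  ultimately show ?thesis
    by (simp only: sum_split_first[OF assms] sum.distrib add_ac cong: sum.cong)
qed

theorem lemma5p5:
  fixes n :: nat and \<Gamma> :: "nat \<Rightarrow> real" and z :: "nat \<Rightarrow> complex"
  assumes "n \<ge> 1"
    and "H0_defined n z"
    and "H0_defined n (z(1 := tau (z 1)))"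
  shows "H0 n (\<Gamma>(1 := - \<Gamma> 1)) (z(1 := tau (z 1))) =
         H0 n \<Gamma> z - 1 / 2 * (\<Sum>k\<in>{1..n} - {1}. \<Gamma> 1 * \<Gamma> k)"
proof -
  define \<Gamma>' where "\<Gamma>' = \<Gamma>(1 := - \<Gamma> 1)"
  define z' where "z' = z(1 := tau (z 1))"
  define D where "D w k l = ln (norm (theta1 (\<i> * (w k - w l)) nome))" for w and k l :: nat
  define R where "R w k l = ln (norm (theta1 (\<i> * (w k - cnj (w l) - of_real pi)) nome))"
    for w and k l :: nat
  define S where "S w k = ln (norm (theta1 (of_real (2 * Im (w k)) + \<i> * of_real pi) nome))"
    for w and k :: nat
  \<comment> \<open>\<open>P\<close> collects the interactions of vortex 1 with vortex
    \<open>l\<close>; \<open>Q\<close> holds everything else, including the self-interaction of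
    vortex 1.\<close>
  define P where "P G w l = - 1 / (2 * pi) * (G 1 * G l * D w 1 l) +
    1 / (4 * pi) * (G 1 * G l * R w 1 l + G l * G 1 * R w l 1)" for G :: "nat \<Rightarrow> real" and w l
  define Q where "Q G w = - 1 / (2 * pi) * (\<Sum>k\<in>{2..n}. \<Sum>l\<in>{k<..n}. G k * G l * D w k l) +
    1 / (4 * pi) * (\<Sum>k\<in>{2..n}. \<Sum>l\<in>{2..n} - {k}. G k * G l * R w k l) +
    1 / (4 * pi) * ((G 1)\<^sup>2 * S w 1 + (\<Sum>k\<in>{2..n}. (G k)\<^sup>2 * S w k))" for G :: "nat \<Rightarrow> real" and w
  have H0_split: "H0 n G w = (\<Sum>l\<in>{2..n}. P G w l) + Q G w" for G w
    unfolding H0_def D_def[symmetric] R_def[symmetric] S_def[symmetric]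
      sum_pairs_split_first[OF assms(1)] sum_distinct_pairs_split_first[OF assms(1)]
      sum_split_first[OF assms(1), of "\<lambda>k. (G k)\<^sup>2 * S w k"] P_def Q_def sum.distrib
      sum_distrib_left[symmetric]
    by (simp add: algebra_simps)

  have self: "S z' 1 = S z 1"
  proof -
    define u where "u = of_real (2 * Im (z 1)) + \<i> * of_real pi"
    \<comment> \<open>\<open>tau\<close> negates \<open>Im (z 1)\<close>, that is, the real part of
      \<open>u\<close>, and leaves the imaginary part \<open>pi\<close> alone.\<close>
    have "of_real (2 * Im (z' 1)) + \<i> * of_real pi = - cnj u"
      by (simp add: z'_def tau_def u_def)
    then show ?thesis
      unfolding S_def u_def[symmetric]
      by (simp only: norm_theta1_nome_minus norm_theta1_nome_cnj)
  qed
  \<comment> \<open>In \<open>Q\<close> the strength of vortex 1 enters only squared, so its sign is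
    lost.\<close>
  have rest: "Q \<Gamma>' z' = Q \<Gamma> z"
    unfolding Q_def self
    by (intro arg_cong2[of _ _ _ _ "(+)"] arg_cong2[of _ _ _ _ "(*)"] sum.cong refl)
      (auto simp: \<Gamma>'_def z'_def D_def R_def S_def)

  have pair: "P \<Gamma>' z' l = P \<Gamma> z l - 1 / 2 * (\<Gamma> 1 * \<Gamma> l)" if l: "l \<in> {2..n}" for l
  proof -
    define d where "d = \<i> * (z 1 - z l)"
    have d0: "theta1 d nome \<noteq> 0"
      using assms(1,2) l unfolding H0_defined_def d_def by auto
    have i0: "theta1 (\<i> * (z 1 - cnj (z l) - of_real pi)) nome \<noteq> 0"
      using assms(1,2) l unfolding H0_defined_def by auto
    have "l \<noteq> 1"
      using l by auto
    then have z': "z' l = z l" "z' 1 = cnj (z 1) + of_real pi"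
      and \<Gamma>': "\<Gamma>' l = \<Gamma> l" "\<Gamma>' 1 = - \<Gamma> 1"
      by (auto simp: z'_def tau_def \<Gamma>'_def)
    have "\<i> * (z' 1 - z' l) = - (\<i> * (z l - cnj (z 1) - of_real pi))"
      unfolding z' by (simp add: algebra_simps)
    then have direct: "D z' 1 l = R z l 1"
      unfolding D_def R_def by (simp only: norm_theta1_nome_minus)
    have "\<i> * (z' 1 - cnj (z' l) - of_real pi) = - cnj d"
      unfolding z' by (simp add: d_def algebra_simps)
    then have image1: "R z' 1 l = D z 1 l"
      unfolding D_def R_def d_def[symmetric]
      by (simp only: norm_theta1_nome_minus norm_theta1_nome_cnj)
    have "\<i> * (z' l - cnj (z' 1) - of_real pi) = - (d + 2 * \<i> * of_real pi)"
      unfolding z' by (simp add: d_def algebra_simps)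
    \<comment> \<open>Unlike \<open>image1\<close>, this order of the pair lands one quasi-period
      away from \<open>d\<close>, which is the source of the constant \<open>2 * pi\<close>.\<close>
    then have "R z' l 1 = D z 1 l + 2 * Im d + 2 * pi"
      unfolding D_def R_def d_def[symmetric]
      by (simp only: norm_theta1_nome_minus ln_norm_theta1_nome_shift[OF d0])
    then have image2: "R z' l 1 = D z 1 l + 2 * Re (z 1 - z l) + 2 * pi"
      by (simp add: d_def)
    have swap: "R z l 1 = R z 1 l + 2 * Re (z 1 - z l)"
      unfolding R_def by (rule ln_norm_theta1_image_swap[OF i0])
    \<comment> \<open>Put \<open>g = \<Gamma> 1 * \<Gamma> l\<close> and
      \<open>x = Re (z 1 - z l)\<close>. The terms in \<open>x\<close> add up to
      \<open>g * x / (2 * pi)\<close> on both sides, and the constant \<open>2 * pi\<close>,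
      weighted by \<open>- g / (4 * pi)\<close>, leaves \<open>- g / 2\<close>.\<close>
    show ?thesis
      unfolding P_def \<Gamma>' direct image1 image2 swap by (simp add: field_simps)
  qed
  have "{1..n} - {1} = {2..n}"
    by auto
  then have "H0 n \<Gamma>' z' = H0 n \<Gamma> z - 1 / 2 * (\<Sum>k\<in>{1..n} - {1}. \<Gamma> 1 * \<Gamma> k)"
    by (simp only: H0_split rest pair sum_subtractf sum_distrib_left cong: sum.cong)
  then show ?thesis
    by (simp only: \<Gamma>'_def z'_def)
qed

end
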